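(* For every integer $n\geq 5$, the signed total Roman domination number of the graph $S_n$ satisfies $\gamma_{stR}(S_n)=n$.
   Context: Graphs are finite, undirected and simple. For a vertex $v$ of a graph $G=(V,E)$, $N(v)=\{u\in V\mid uv\in E\}$. A signed total Roman domination (STRD) function on $G$ is a function $f:V\to\{-1,1,2\}$ such that (i) $\sum_{u\in N(v)}f(u)\geq 1$ for every $v\in V$, and (ii) every $v\in V$ with $f(v)=-1$ has a neighbor $u\in N(v)$ with $f(u)=2$. The weight of $f$ is $f(V)=\sum_{v\in V}f(v)$, and the signed total Roman domination number $\gamma_{stR}(G)$ is the minimum weight of an STRD function on $G$. The graph $S_n$ has $4n$ distinct vertices $V(S_n)=\{a_i,b_i,c_i,d_i\mid i=0,\ldots,n-1\}$ and edge set $E(S_n)=\{a_ia_{i+1},\,b_ib_{i+1},\,c_ic_{i+1},\,d_id_{i+1},\,a_ib_i,\,b_ic_i,\,c_id_i,\,a_{i+1}b_i\mid i=0,\ldots,n-1\}$, with vertex indices taken modulo $n$. *)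

theory Defs
  imports "Graph_Theory.Pair_Digraph" "HOL-Library.FuncSet"
begin

text \<open>
  Finite simple undirected graphs are symmetric, loop-free pair digraphs, as in the locale
  \<^locale>\<open>pair_graph\<close>: the undirected edge $uv$ is the pair of arcs $(u,v)$ and $(v,u)$.
\<close>

definition neighborhood :: "'a pair_pre_digraph \<Rightarrow> 'a \<Rightarrow> 'a set" where
  "neighborhood G v = {u \<in> pverts G. (v, u) \<in> parcs G}"

definition strd_function :: "'a pair_pre_digraph \<Rightarrow> ('a \<Rightarrow> int) \<Rightarrow> bool" where
  "strd_function G f \<longleftrightarrow>
     f \<in> pverts G \<rightarrow> {-1, 1, 2} \<and>
     (\<forall>v \<in> pverts G. (\<Sum>u \<in> neighborhood G v. f u) \<ge> 1) \<and>
     (\<forall>v \<in> pverts G. f v = -1 \<longrightarrow> (\<exists>u \<in> neighborhood G v. f u = 2))"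

definition weight :: "'a pair_pre_digraph \<Rightarrow> ('a \<Rightarrow> int) \<Rightarrow> int" where
  "weight G f = (\<Sum>v \<in> pverts G. f v)"

text \<open>
  The values of \<open>f\<close> outside the vertex set are unconstrained but irrelevant to its weight, so
  the set of weights is finite. It is nonempty iff no vertex is isolated (take \<open>f\<close> constantly 1);
  otherwise the minimum is unspecified.
\<close>

definition strd_number :: "'a pair_pre_digraph \<Rightarrow> int" (\<open>\<gamma>\<^sub>s\<^sub>t\<^sub>R\<close>) where
  "\<gamma>\<^sub>s\<^sub>t\<^sub>R G = Min {weight G f | f. strd_function G f}"

lemma finite_strd_weights:
  assumes "finite (pverts G)"
  shows "finite {weight G f | f. strd_function G f}"
proof (rule finite_subset)
  show "{weight G f | f. strd_function G f} \<subseteq> weight G ` (pverts G \<rightarrow>\<^sub>E {-1, 1, 2})"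
  proof clarify
    fix f assume "strd_function G f"
    then have "restrict f (pverts G) \<in> pverts G \<rightarrow>\<^sub>E {-1, 1, 2}"
      by (auto simp: strd_function_def)
    moreover have "weight G f = weight G (restrict f (pverts G))"
      by (simp add: weight_def)
    ultimately show "weight G f \<in> weight G ` (pverts G \<rightarrow>\<^sub>E {-1, 1, 2})"
      by blast
  qed
  show "finite (weight G ` (pverts G \<rightarrow>\<^sub>E {-1, 1, 2}))"
    using assms by (intro finite_imageI finite_PiE) auto
qed

datatype S_vertex = A nat | B nat | C nat | D nat

definition S_edges :: "nat \<Rightarrow> (S_vertex \<times> S_vertex) set" where
  "S_edges n = (\<Union>i<n. let j = (i + 1) mod n in
     {(A i, A j), (B i, B j), (C i, C j), (D i, D j),
      (A i, B i), (B i, C i), (C i, D i), (A j, B i)})"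

definition S_graph :: "nat \<Rightarrow> S_vertex pair_pre_digraph" where
  "S_graph n = \<lparr> pverts = (\<Union>i<n. {A i, B i, C i, D i}),
                 parcs = S_edges n \<union> (S_edges n)\<inverse> \<rparr>"

lemma card_pverts_S_graph: "card (pverts (S_graph n)) = 4 * n"
proof -
  have "card (\<Union>i<n. {A i, B i, C i, D i}) = (\<Sum>i<n. card {A i, B i, C i, D i})"
    by (rule card_UN_disjoint) auto
  then show ?thesis by (simp add: S_graph_def)
qed

lemma pair_graph_S_graph:
  assumes "n \<ge> 2"
  shows "pair_graph (S_graph n)"
proof -
  have *: "(i + 1) mod n < n" "(i + 1) mod n \<noteq> i" if "i < n" for i
    using that assms by (cases "i + 1 = n"; simp)+
  show ?thesis
  proof
    show "\<And>e. e \<in> parcs (S_graph n) \<Longrightarrow> fst e \<in> pverts (S_graph n)"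
      using * by (auto simp: S_graph_def S_edges_def Let_def)
    show "\<And>e. e \<in> parcs (S_graph n) \<Longrightarrow> snd e \<in> pverts (S_graph n)"
      using * by (auto simp: S_graph_def S_edges_def Let_def)
    show "\<And>e. e \<in> parcs (S_graph n) \<Longrightarrow> fst e \<noteq> snd e"
      using *(2) by (fastforce simp: S_graph_def S_edges_def Let_def)
    show "finite (pverts (S_graph n))" "finite (parcs (S_graph n))"
      by (auto simp: S_graph_def S_edges_def Let_def)
    show "symmetric (with_proj (S_graph n))"
      by (auto simp: S_graph_def symmetric_def arcs_ends_conv sym_def)
  qed
qed

end

theory Submission
  imports Defs
begin

text \<open>
  Every vertex \<open>a\<^sub>i\<close>, \<open>b\<^sub>i\<close>, \<open>c\<^sub>i\<close>, \<open>d\<^sub>i\<close> lies in the open neighbourhoods of exactly two of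
  the \<open>2 n\<close> vertices \<open>b\<^sub>j\<close> and \<open>d\<^sub>j\<close>. Adding the neighbourhood conditions of these vertices
  therefore counts the weight twice, and gives the lower bound \<open>n\<close>. It is attained by the function
  that is constantly \<open>-1, 2, -1, 1\<close> on the four cycles.
\<close>

definition cyc_suc :: "nat \<Rightarrow> nat \<Rightarrow> nat" where
  "cyc_suc n i = (i + 1) mod n"

text \<open>Subtraction on naturals truncates, so \<open>(i - 1) mod n\<close> would give 0 instead
  of \<open>n - 1\<close> at \<open>i = 0\<close>; hence the case split.\<close>

definition cyc_pred :: "nat \<Rightarrow> nat \<Rightarrow> nat" where
  "cyc_pred n i = (if i = 0 then n - 1 else i - 1)"

lemma cyc_suc_eq: "i < n \<Longrightarrow> cyc_suc n i = (if i + 1 = n then 0 else i + 1)"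
  by (simp add: cyc_suc_def)

lemma cyc_suc_less: "i < n \<Longrightarrow> cyc_suc n i < n"
  by (simp add: cyc_suc_def)

lemma cyc_pred_less: "i < n \<Longrightarrow> cyc_pred n i < n"
  by (auto simp: cyc_pred_def)

text \<open>On a cycle of length 2 both neighbours of an index coincide. Length at least 3 excludes
  this, so that neighbours on the same cycle count separately in sums over neighbourhoods.\<close>

lemma cyc_suc_neq_pred:
  assumes "n \<ge> 3" "i < n"
  shows "cyc_suc n i \<noteq> cyc_pred n i"
  using assms by (auto simp: cyc_suc_eq cyc_pred_def)

lemma cyc_pred_suc: "i < n \<Longrightarrow> cyc_pred n (cyc_suc n i) = i"
  by (auto simp: cyc_suc_eq cyc_pred_def)

lemma cyc_suc_pred: "i < n \<Longrightarrow> cyc_suc n (cyc_pred n i) = i"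
  by (auto simp: cyc_suc_eq cyc_pred_def)

lemma bij_betw_cyc_suc: "bij_betw (cyc_suc n) {..<n} {..<n}"
  by (rule bij_betw_byWitness[where f' = "cyc_pred n"])
     (auto simp: cyc_suc_less cyc_pred_less cyc_pred_suc cyc_suc_pred)

lemma bij_betw_cyc_pred: "bij_betw (cyc_pred n) {..<n} {..<n}"
  by (rule bij_betw_byWitness[where f' = "cyc_suc n"])
     (auto simp: cyc_suc_less cyc_pred_less cyc_pred_suc cyc_suc_pred)

lemma sum_cyc_suc: "(\<Sum>i<n. g (cyc_suc n i)) = (\<Sum>i<n. g i)"
  by (rule sum.reindex_bij_betw[OF bij_betw_cyc_suc])

lemma sum_cyc_pred: "(\<Sum>i<n. g (cyc_pred n i)) = (\<Sum>i<n. g i)"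
  by (rule sum.reindex_bij_betw[OF bij_betw_cyc_pred])

lemma pverts_S_graph: "pverts (S_graph n) = (\<Union>i<n. {A i, B i, C i, D i})"
  by (simp add: S_graph_def)

lemma parcs_S_graph_iff:
  "(u, v) \<in> parcs (S_graph n) \<longleftrightarrow> (u, v) \<in> S_edges n \<or> (v, u) \<in> S_edges n"
  by (auto simp: S_graph_def)

lemma S_edges_eq:
  "S_edges n = (\<Union>i<n. let j = cyc_suc n i in
     {(A i, A j), (B i, B j), (C i, C j), (D i, D j),
      (A i, B i), (B i, C i), (C i, D i), (A j, B i)})"
  by (simp add: S_edges_def cyc_suc_def)

lemma neighborhood_S_graph:
  assumes "i < n"
  shows "neighborhood (S_graph n) (A i) =
           {A (cyc_suc n i), A (cyc_pred n i), B i, B (cyc_pred n i)}"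
    and "neighborhood (S_graph n) (B i) =
           {B (cyc_suc n i), B (cyc_pred n i), A i, A (cyc_suc n i), C i}"
    and "neighborhood (S_graph n) (C i) =
           {C (cyc_suc n i), C (cyc_pred n i), B i, D i}"
    and "neighborhood (S_graph n) (D i) =
           {D (cyc_suc n i), D (cyc_pred n i), C i}"
  using assms cyc_suc_less[OF assms] cyc_pred_less[OF assms] cyc_suc_pred[OF assms]
  \<comment> \<open>An edge at a vertex of index \<open>i\<close> is generated by \<open>i\<close>
    itself or by the index whose successor is \<open>i\<close>; hence the two witnesses.\<close>
  by (auto simp: neighborhood_def pverts_S_graph parcs_S_graph_iff S_edges_eq Let_def
      cyc_pred_suc intro: bexI[of _ i] bexI[of _ "cyc_pred n i"])

lemma sum_neighborhood_S_graph:
  fixes f :: "S_vertex \<Rightarrow> int"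
  assumes "n \<ge> 3" "i < n"
  shows "sum f (neighborhood (S_graph n) (A i)) =
           f (A (cyc_suc n i)) + f (A (cyc_pred n i)) + f (B i) + f (B (cyc_pred n i))"
    and "sum f (neighborhood (S_graph n) (B i)) =
           f (B (cyc_suc n i)) + f (B (cyc_pred n i)) + f (A i) + f (A (cyc_suc n i)) + f (C i)"
    and "sum f (neighborhood (S_graph n) (C i)) =
           f (C (cyc_suc n i)) + f (C (cyc_pred n i)) + f (B i) + f (D i)"
    and "sum f (neighborhood (S_graph n) (D i)) =
           f (D (cyc_suc n i)) + f (D (cyc_pred n i)) + f (C i)"
proof -
  \<comment> \<open>With \<open>cyc_suc_neq_pred\<close> this makes the listed neighbours pairwise
    distinct, so each contributes its own term to the sum over the set.\<close>
  have "cyc_suc n i \<noteq> i" "cyc_pred n i \<noteq> i"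
    using assms by (auto simp: cyc_suc_eq cyc_pred_def)
  then show "sum f (neighborhood (S_graph n) (A i)) =
           f (A (cyc_suc n i)) + f (A (cyc_pred n i)) + f (B i) + f (B (cyc_pred n i))"
    and "sum f (neighborhood (S_graph n) (B i)) =
           f (B (cyc_suc n i)) + f (B (cyc_pred n i)) + f (A i) + f (A (cyc_suc n i)) + f (C i)"
    and "sum f (neighborhood (S_graph n) (C i)) =
           f (C (cyc_suc n i)) + f (C (cyc_pred n i)) + f (B i) + f (D i)"
    and "sum f (neighborhood (S_graph n) (D i)) =
           f (D (cyc_suc n i)) + f (D (cyc_pred n i)) + f (C i)"
    using cyc_suc_neq_pred[OF assms]
    by (auto simp: neighborhood_S_graph[OF assms(2)] dest: sym)
qed

lemma weight_S_graph:
  "weight (S_graph n) f = (\<Sum>i<n. f (A i) + f (B i) + f (C i) + f (D i))"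
  unfolding weight_def pverts_S_graph
  by (subst sum.UNION_disjoint) (auto simp: add.assoc)

lemma weight_S_graph_ge:
  assumes n: "n \<ge> 3" and f: "strd_function (S_graph n) f"
  shows "weight (S_graph n) f \<ge> int n"
proof -
  have "sum f (neighborhood (S_graph n) (B i)) \<ge> 1"
       "sum f (neighborhood (S_graph n) (D i)) \<ge> 1" if "i < n" for i
    using f that by (auto simp: strd_function_def pverts_S_graph)
  \<comment> \<open>The 2 is one unit from \<open>B i\<close> and one from
    \<open>D i\<close>.\<close>
  then have "(\<Sum>i<n. 2) \<le> (\<Sum>i<n. sum f (neighborhood (S_graph n) (B i)) +
                                    sum f (neighborhood (S_graph n) (D i)))"
    by (intro sum_mono) (fastforce intro: add_mono[of 1 _ "1::int", simplified])
  also have "\<dots> = (\<Sum>i<n. f (B (cyc_suc n i)) + f (B (cyc_pred n i)) + f (A i) +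
                     f (A (cyc_suc n i)) + f (C i) +
                     (f (D (cyc_suc n i)) + f (D (cyc_pred n i)) + f (C i)))"
    by (intro sum.cong) (simp_all add: sum_neighborhood_S_graph[OF n])
  \<comment> \<open>Rotating the summation index removes the shifts. The \<open>A\<close> values
    then occur once unshifted and once shifted, the \<open>B\<close> and \<open>D\<close> values as
    two shifts each, and the \<open>C\<close> values once from each of the two kinds of
    neighbourhood.\<close>
  also have "\<dots> = 2 * weight (S_graph n) f"
    by (simp add: weight_S_graph sum.distrib sum_distrib_left[symmetric]
        sum_cyc_suc[of "\<lambda>i. f (A i)"]
        sum_cyc_suc[of "\<lambda>i. f (B i)"] sum_cyc_suc[of "\<lambda>i. f (D i)"]
        sum_cyc_pred[of "\<lambda>i. f (B i)"] sum_cyc_pred[of "\<lambda>i. f (D i)"])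
  finally show ?thesis by simp
qed

text \<open>Equality in the lower bound forces every neighbourhood sum at \<open>B i\<close> and
  \<open>D i\<close> to be exactly 1. Here these are 2+2-1-1-1 and 1+1-1; the sums at
  \<open>A i\<close> and \<open>C i\<close> are 2 and 1.\<close>

fun S_strd :: "S_vertex \<Rightarrow> int" where
  "S_strd (A _) = -1"
| "S_strd (B _) = 2"
| "S_strd (C _) = -1"
| "S_strd (D _) = 1"

lemma strd_function_S_strd:
  assumes "n \<ge> 3"
  shows "strd_function (S_graph n) S_strd"
  unfolding strd_function_def
proof (intro conjI)
  show "\<forall>v \<in> pverts (S_graph n). (\<Sum>u \<in> neighborhood (S_graph n) v. S_strd u) \<ge> 1"
    by (auto simp: pverts_S_graph sum_neighborhood_S_graph[OF assms])
  \<comment> \<open>The value -1 occurs only at \<open>A i\<close> and \<open>C i\<close>, both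
    adjacent to \<open>B i\<close> of value 2.\<close>
  show "\<forall>v \<in> pverts (S_graph n). S_strd v = -1 \<longrightarrow>
          (\<exists>u \<in> neighborhood (S_graph n) v. S_strd u = 2)"
    by (auto simp: pverts_S_graph neighborhood_S_graph)
qed (auto simp: pverts_S_graph)

lemma weight_S_strd: "weight (S_graph n) S_strd = int n"
  by (simp add: weight_S_graph)

theorem theorem3:
  fixes n :: nat
  assumes "n \<ge> 5"
  shows "\<gamma>\<^sub>s\<^sub>t\<^sub>R (S_graph n) = int n"
  unfolding strd_number_def
proof (rule Min_eqI)
  show "finite {weight (S_graph n) f | f. strd_function (S_graph n) f}"
    by (rule finite_strd_weights) (simp add: pverts_S_graph)
  show "int n \<in> {weight (S_graph n) f | f. strd_function (S_graph n) f}"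
    using strd_function_S_strd[of n] weight_S_strd[of n] assms by force
  show "int n \<le> w" if "w \<in> {weight (S_graph n) f | f. strd_function (S_graph n) f}" for w
    using that weight_S_graph_ge[of n] assms by auto
qed

end
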